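(* For every radical expression $f(x_1,\dots,x_n)$, the recursive procedure $\mathrm{RecursiveDefPoly}$ (described in the context), applied to $f$, terminates and returns a defining polynomial of $f$, i.e. a polynomial $p(z,x_1,\dots,x_n)$ such that $p(f(x_1,\dots,x_n),x_1,\dots,x_n)$ is identically zero.
   Context: A radical expression in $x_1,\dots,x_n$ is an expression built from polynomials in $\mathbb{Q}[x_1,\dots,x_n]$ by finitely many additions, subtractions, multiplications, divisions, and rational exponents. A power $g^{r/s}$ with positive integers $r,s$ is treated as $\sqrt[s]{g^r}$, and negative exponents are treated as division by the corresponding positive power, so that only $+,-,\times,/$ and $\sqrt[r]{\cdot}$ with $r$ a positive integer need be considered. A defining polynomial of a radical expression $f(x_1,\dots,x_n)$ is a polynomial $p(z,x_1,\dots,x_n)$ with rational coefficients such that $p(f(x_1,\dots,x_n),x_1,\dots,x_n)$ is identically zero. For polynomials $p,q$ viewed as polynomials in a variable $t$ of degrees $d$ and $e$ (with coefficients that are polynomials in the other variables), $\operatorname{Res}_t(p,q)$ is the determinant of the $(d+e)\times(d+e)$ Sylvester matrix, whose rows are $t^{e-1}p,\dots,p,t^{d-1}q,\dots,q$ written as coefficient vectors in the basis $t^{d+e-1},\dots,t,1$. The procedure $\mathrm{RecursiveDefPoly}(f)$ is as follows. Below $p_g(z)$ and $p_h(z)$ denote the outputs of $\mathrm{RecursiveDefPoly}(g)$ and $\mathrm{RecursiveDefPoly}(h)$, viewed as polynomials in the main variable $z$ (dependence on $x_1,\dots,x_n$ suppressed); $p_g(w)$ means that $w$ is substituted for $z$;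 $t$ is an auxiliary variable. The cases are tested in order. - If $f$ is a polynomial, return $z-f$. - If $f=g+h$, return $\operatorname{Res}_t(p_g(z-t),p_h(t))$. - If $f=g-h$, return $\operatorname{Res}_t(p_g(z+t),p_h(t))$. - If $f=g\times h$, return $\operatorname{Res}_t(t^d\,p_g(z/t),p_h(t))$, where $d$ is the degree of $p_g$ in $z$. - If $f=g/h$, return $\operatorname{Res}_t(p_g(tz),p_h(t))$. - If $f=\sqrt[r]{g}$ with $r$ a positive integer, return $\operatorname{Res}_t(z^r-t,p_g(t))$. *)

theory Defs
  imports
    "HOL-Library.Poly_Mapping"
    "Subresultants.Resultant_Prelim"
    Complex_Main
begin

section \<open>Polynomials in \<open>x\<^sub>1, \<dots>, x\<^sub>n\<close> over the rationals\<close>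

text \<open>The variables are indexed by a type \<open>'n\<close>, to be used with \<open>'n :: finite\<close>; a polynomial maps
  exponent vectors to coefficients. A polynomial in the main variable \<open>z\<close> and \<open>x\<^sub>1, \<dots>, x\<^sub>n\<close> is an
  element of \<open>'n mpoly poly\<close>.\<close>

type_synonym 'n mpoly = "('n \<Rightarrow>\<^sub>0 nat) \<Rightarrow>\<^sub>0 rat"

definition mpoly_eval :: "('n::finite \<Rightarrow> complex) \<Rightarrow> 'n mpoly \<Rightarrow> complex" where
  "mpoly_eval x P =
     (\<Sum>m\<in>Poly_Mapping.keys P. of_rat (Poly_Mapping.lookup P m) * (\<Prod>i\<in>UNIV. x i ^ Poly_Mapping.lookup m i))"

definition zpoly_eval :: "('n::finite \<Rightarrow> complex) \<Rightarrow> complex \<Rightarrow> 'n mpoly poly \<Rightarrow> complex" where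
  "zpoly_eval x v p = poly (map_poly (mpoly_eval x) p) v"


section \<open>Radical expressions\<close>

text \<open>\<open>RRoot r g\<close> is \<open>\<surd>[r]{g}\<close>. A power \<open>g\<^sup>r\<^sup>/\<^sup>s\<close> is \<open>RRoot s\<close> of an \<open>r\<close>-fold product, and a negative
  exponent is a division.\<close>

datatype 'n rexp =
    RPoly "'n mpoly"
  | RAdd "'n rexp" "'n rexp"
  | RSub "'n rexp" "'n rexp"
  | RMul "'n rexp" "'n rexp"
  | RDiv "'n rexp" "'n rexp"
  | RRoot nat "'n rexp"

primrec radical_expression :: "'n rexp \<Rightarrow> bool" where
  "radical_expression (RPoly P) \<longleftrightarrow> True"
| "radical_expression (RAdd g h) \<longleftrightarrow> radical_expression g \<and> radical_expression h"
| "radical_expression (RSub g h) \<longleftrightarrow> radical_expression g \<and> radical_expression h"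
| "radical_expression (RMul g h) \<longleftrightarrow> radical_expression g \<and> radical_expression h"
| "radical_expression (RDiv g h) \<longleftrightarrow> radical_expression g \<and> radical_expression h"
| "radical_expression (RRoot r g) \<longleftrightarrow> r > 0 \<and> radical_expression g"

text \<open>\<open>has_value x f v\<close>: \<open>v\<close> is a value of \<open>f\<close> at the point \<open>x\<close>. Radicals are multivalued, so that
  every choice of branches of the radicals (principal roots, real roots of real numbers, analytic
  branches, \<dots>) yields a function \<open>F\<close> with \<open>has_value x f (F x)\<close> at every point \<open>x\<close> at which no
  denominator vanishes; \<open>f\<close> has no value where a denominator vanishes for all choices.\<close>

inductive has_value :: "('n::finite \<Rightarrow> complex) \<Rightarrow> 'n rexp \<Rightarrow> complex \<Rightarrow> bool"
  for x :: "'n \<Rightarrow> complex" where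
  "has_value x (RPoly P) (mpoly_eval x P)"
| "has_value x g u \<Longrightarrow> has_value x h w \<Longrightarrow> has_value x (RAdd g h) (u + w)"
| "has_value x g u \<Longrightarrow> has_value x h w \<Longrightarrow> has_value x (RSub g h) (u - w)"
| "has_value x g u \<Longrightarrow> has_value x h w \<Longrightarrow> has_value x (RMul g h) (u * w)"
| "has_value x g u \<Longrightarrow> has_value x h w \<Longrightarrow> w \<noteq> 0 \<Longrightarrow> has_value x (RDiv g h) (u / w)"
| "has_value x g u \<Longrightarrow> v ^ r = u \<Longrightarrow> has_value x (RRoot r g) v"

definition defining_polynomial :: "'n::finite mpoly poly \<Rightarrow> 'n rexp \<Rightarrow> bool" where
  "defining_polynomial p f \<longleftrightarrow> (\<forall>x v. has_value x f v \<longrightarrow> zpoly_eval x v p = 0)"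


section \<open>The recursive procedure\<close>

text \<open>The polynomial denoted by an expression that is a polynomial, i.e. that is built from
  polynomials by addition, subtraction, multiplication and division by nonzero constants.\<close>

primrec as_poly :: "'n rexp \<Rightarrow> 'n mpoly option" where
  "as_poly (RPoly P) = Some P"
| "as_poly (RAdd g h) =
     (case (as_poly g, as_poly h) of (Some P, Some Q) \<Rightarrow> Some (P + Q) | _ \<Rightarrow> None)"
| "as_poly (RSub g h) =
     (case (as_poly g, as_poly h) of (Some P, Some Q) \<Rightarrow> Some (P - Q) | _ \<Rightarrow> None)"
| "as_poly (RMul g h) =
     (case (as_poly g, as_poly h) of (Some P, Some Q) \<Rightarrow> Some (P * Q) | _ \<Rightarrow> None)"
| "as_poly (RDiv g h) =
     (case (as_poly g, as_poly h) of
        (Some P, Some Q) \<Rightarrow>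
          if Poly_Mapping.keys Q = {0}
          then Some (P * Poly_Mapping.single 0 (inverse (Poly_Mapping.lookup Q 0)))
          else None
      | _ \<Rightarrow> None)"
| "as_poly (RRoot r g) = None"

text \<open>The library constant \<open>resultant\<close> is the determinant of the Sylvester matrix of size
  \<open>degree p + degree q\<close>, with \<open>degree 0 = 0\<close>; hence \<open>resultant 0 0\<close> is an empty determinant, \<open>1\<close>.
  The zero polynomial does occur as an output of the procedure, e.g. for \<open>(\<surd>x + \<surd>x) / (\<surd>x + \<surd>x)\<close>;
  a resultant with the zero polynomial is taken to be \<open>0\<close>, as usual.\<close>

definition Res :: "'a::comm_ring_1 poly \<Rightarrow> 'a poly \<Rightarrow> 'a" where
  "Res p q = (if p = 0 \<or> q = 0 then 0 else resultant p q)"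

text \<open>Polynomials in \<open>t\<close> whose coefficients are polynomials in \<open>z\<close> are elements of \<open>'a poly poly\<close>, with
  \<open>t\<close> the outer and \<open>z\<close> the inner variable.\<close>

abbreviation var_t :: "'a::comm_ring_1 poly poly" where
  "var_t \<equiv> [:0, 1:]"

abbreviation var_z :: "'a::comm_ring_1 poly poly" where
  "var_z \<equiv> [:[:0, 1:]:]"

text \<open>\<open>psubst p s\<close> is \<open>p(s)\<close>, the result of substituting \<open>s\<close> for the variable of \<open>p\<close>.\<close>

definition psubst :: "'a::comm_ring_1 poly \<Rightarrow> 'a poly poly \<Rightarrow> 'a poly poly" where
  "psubst p s = poly (map_poly (\<lambda>c. [:[:c:]:]) p) s"

text \<open>\<open>t\<^sup>d p(z/t)\<close>, where \<open>d\<close> is the degree of \<open>p\<close>\<close>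

definition homogenize :: "'a::comm_ring_1 poly \<Rightarrow> 'a poly poly" where
  "homogenize p = (\<Sum>i\<le>degree p. [:[:coeff p i:]:] * var_z ^ i * var_t ^ (degree p - i))"

text \<open>A partial function: termination is the statement that the domain predicate
  \<open>RecursiveDefPoly_dom\<close> holds.\<close>

function (domintros) RecursiveDefPoly :: "'n rexp \<Rightarrow> 'n mpoly poly" where
  "RecursiveDefPoly f =
    (case as_poly f of
       Some P \<Rightarrow> [:- P, 1:]
     | None \<Rightarrow>
       (case f of
          RPoly P \<Rightarrow> [:- P, 1:]
        | RAdd g h \<Rightarrow>
            Res (psubst (RecursiveDefPoly g) (var_z - var_t)) (psubst (RecursiveDefPoly h) var_t)
        | RSub g h \<Rightarrow>
            Res (psubst (RecursiveDefPoly g) (var_z + var_t)) (psubst (RecursiveDefPoly h) var_t)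
        | RMul g h \<Rightarrow>
            Res (homogenize (RecursiveDefPoly g)) (psubst (RecursiveDefPoly h) var_t)
        | RDiv g h \<Rightarrow>
            Res (psubst (RecursiveDefPoly g) (var_t * var_z)) (psubst (RecursiveDefPoly h) var_t)
        | RRoot r g \<Rightarrow>
            Res (var_z ^ r - var_t) (psubst (RecursiveDefPoly g) var_t)))"
  by pat_completeness auto

end

theory Submission
  imports "HOL-Analysis.Complex_Transcendental" Defs
begin

text \<open>If \<open>p\<close> and \<open>q\<close> have a common root \<open>w\<close> after specialisation, the specialised Sylvester matrix
  annihilates the column \<open>(w\<^sup>N\<^sup>-\<^sup>1, \<dots>, w, 1)\<close>, so the resultant specialises to \<open>0\<close>, even if leading
  coefficients vanish. The only obstruction is \<open>N = 0\<close>, when the determinant is empty. It could arise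
  only if the second operand \<open>h\<close> had a nonzero defining polynomial \<open>c\<close> free of \<open>z\<close>. But then \<open>h\<close> has no
  value anywhere: a value at \<open>x\<close> persists at all points near \<open>x\<close> by continuity of roots, whereas the
  nonzero polynomial \<open>c\<close> is nonzero at points arbitrarily close to \<open>x\<close>.\<close>

section \<open>Resultants and common roots\<close>

lemma poly_eq_sum_coeff:
  fixes p :: "'a::comm_semiring_1 poly"
  assumes "degree p \<le> m"
  shows "poly p w = (\<Sum>k\<le>m. coeff p k * w ^ k)"
  unfolding poly_altdef
  using assms by (intro sum.mono_neutral_left) (auto simp: coeff_eq_0)

text \<open>Row \<open>i < n\<close> lists the coefficients of \<open>t^(n-1-i) * p\<close>, row
  \<open>i \<ge> n\<close> those of \<open>t^(m+n-1-i) * q\<close>; pairing a row with the powers of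
  \<open>w\<close> evaluates that polynomial at \<open>w\<close>. Formal degrees \<open>m\<close>,
  \<open>n\<close> allow leading coefficients to vanish.\<close>

lemma sylvester_mat_sub_mult_powers:
  fixes p q :: "'a::comm_ring_1 poly"
  assumes "degree p \<le> m" "degree q \<le> n" "poly p w = 0" "poly q w = 0"
  shows "sylvester_mat_sub m n p q *\<^sub>v vec (m + n) (\<lambda>j. w ^ (m + n - 1 - j)) = 0\<^sub>v (m + n)"
proof (rule eq_vecI)
  fix i assume "i < dim_vec (0\<^sub>v (m + n))"
  hence i: "i < m + n" by simp
  let ?S = "sylvester_mat_sub m n p q"
  have "(?S *\<^sub>v vec (m + n) (\<lambda>j. w ^ (m + n - 1 - j))) $ i =
      (\<Sum>j<m+n. ?S $$ (i, j) * w ^ (m + n - 1 - j))"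
    using i by (simp add: scalar_prod_def atLeast0LessThan)
  also have "\<dots> = 0"
  proof (cases "i < n")
    case True
    have "(\<Sum>j<m+n. ?S $$ (i, j) * w ^ (m + n - 1 - j)) =
        (\<Sum>j\<in>{i..i+m}. coeff p (m + i - j) * w ^ (m + n - 1 - j))"
      using True i
      by (intro sum.mono_neutral_cong_right) (auto simp: sylvester_mat_sub_index)
    \<comment> \<open>With \<open>k = m + i - j\<close> the exponent \<open>m + n - 1 - j\<close>
      becomes \<open>n - 1 - i + k\<close>; \<open>i < n\<close> keeps \<open>n - 1 - i\<close> from
      being truncated.\<close>
    also have "\<dots> = (\<Sum>k\<le>m. coeff p k * w ^ (n - 1 - i + k))"
      using True
      by (intro sum.reindex_bij_witness[of _ "\<lambda>k. m + i - k" "\<lambda>j. m + i - j"]) (auto simp: add.commute)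
    also have "\<dots> = w ^ (n - 1 - i) * poly p w"
      by (simp add: poly_eq_sum_coeff[OF assms(1)] sum_distrib_left power_add mult_ac)
    finally show ?thesis using assms by simp
  next
    case False
    have "(\<Sum>j<m+n. ?S $$ (i, j) * w ^ (m + n - 1 - j)) =
        (\<Sum>j\<in>{i-n..i}. coeff q (i - j) * w ^ (m + n - 1 - j))"
      using False i
      by (intro sum.mono_neutral_cong_right) (auto simp: sylvester_mat_sub_index)
    also have "\<dots> = (\<Sum>k\<le>n. coeff q k * w ^ (m + n - 1 - i + k))"
      using False i
      by (intro sum.reindex_bij_witness[of _ "\<lambda>k. i - k" "\<lambda>j. i - j"]) auto
    also have "\<dots> = w ^ (m + n - 1 - i) * poly q w"
      by (simp add: poly_eq_sum_coeff[OF assms(2)] sum_distrib_left power_add mult_ac)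
    finally show ?thesis using assms by simp
  qed
  finally show "(?S *\<^sub>v vec (m + n) (\<lambda>j. w ^ (m + n - 1 - j))) $ i = 0\<^sub>v (m + n) $ i"
    using i by simp
qed simp

text \<open>The degrees of \<open>p\<close> and \<open>q\<close> may drop under \<open>h\<close>: the matrix keeps its size.\<close>

lemma hom_Res_eq_0:
  fixes h :: "'a::comm_ring_1 \<Rightarrow> 'b::idom"
  assumes "comm_ring_hom h"
  assumes deg: "degree p + degree q > 0"
    and roots: "poly (map_poly h p) w = 0" "poly (map_poly h q) w = 0"
  shows "h (Res p q) = 0"
proof -
  interpret h: comm_ring_hom h by fact
  define m n where "m = degree p" and "n = degree q"
  let ?S = "sylvester_mat_sub m n (map_poly h p) (map_poly h q)"
  let ?v = "vec (m + n) (\<lambda>j. w ^ (m + n - 1 - j))"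
  \<comment> \<open>The last entry of the column is \<open>w ^ 0 = 1\<close>, so the column is
    nonzero even for \<open>w = 0\<close>; the entry exists because the total degree is
    positive.\<close>
  have "?v $ (m + n - 1) = 1"
    using deg by (simp add: m_def n_def)
  moreover have "0\<^sub>v (m + n) $ (m + n - 1) = (0 :: 'b)"
    using deg by (simp add: m_def n_def)
  ultimately have nz: "?v \<noteq> 0\<^sub>v (m + n)"
    by auto
  have "?S *\<^sub>v ?v = 0\<^sub>v (m + n)"
    by (rule sylvester_mat_sub_mult_powers[OF _ _ roots]) (simp_all add: m_def n_def degree_map_poly_le)
  moreover have "?S \<in> carrier_mat (m + n) (m + n)"
    by (rule sylvester_mat_sub_carrier)
  ultimately have "det ?S = 0"
    using nz by (subst det_0_iff_vec_prod_zero) (auto intro!: exI[of _ ?v])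
  moreover have "h (resultant p q) = det ?S"
    by (simp add: resultant_def sylvester_mat_def h.hom_det [symmetric] sylvester_mat_sub_map m_def n_def)
  ultimately show ?thesis
    by (simp add: Res_def)
qed

section \<open>Evaluation\<close>

text \<open>A common index set makes addition termwise, since cancellation can make
  \<open>keys (P + Q)\<close> smaller than the union of the keys.\<close>

lemma mpoly_eval_superset:
  assumes "finite S" "Poly_Mapping.keys P \<subseteq> S"
  shows "mpoly_eval x P =
    (\<Sum>m\<in>S. of_rat (Poly_Mapping.lookup P m) * (\<Prod>i\<in>UNIV. x i ^ Poly_Mapping.lookup m i))"
  unfolding mpoly_eval_def
  using assms by (intro sum.mono_neutral_left) (auto simp: in_keys_iff)

lemma mpoly_eval_add: "mpoly_eval x (P + Q) = mpoly_eval x P + mpoly_eval x Q"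
proof -
  let ?S = "Poly_Mapping.keys P \<union> Poly_Mapping.keys Q"
  have "finite ?S" "Poly_Mapping.keys (P + Q) \<subseteq> ?S"
    using Poly_Mapping.keys_add[of P Q] by auto
  thus ?thesis
    by (simp add: mpoly_eval_superset[of ?S] lookup_add of_rat_add algebra_simps sum.distrib)
qed

lemma mpoly_eval_0: "mpoly_eval x 0 = 0"
  by (simp add: mpoly_eval_def)

lemma mpoly_eval_single:
  "mpoly_eval x (Poly_Mapping.single m c) = of_rat c * (\<Prod>i\<in>UNIV. x i ^ Poly_Mapping.lookup m i)"
  by (subst mpoly_eval_superset[of "{m}"]) auto

lemma mpoly_eval_sum: "mpoly_eval x (\<Sum>a\<in>A. P a) = (\<Sum>a\<in>A. mpoly_eval x (P a))"
  by (induction A rule: infinite_finite_induct) (simp_all add: mpoly_eval_0 mpoly_eval_add)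

lemma poly_mapping_eq_sum_single:
  "P = (\<Sum>m\<in>Poly_Mapping.keys P. Poly_Mapping.single m (Poly_Mapping.lookup P m))"
  by (rule poly_mapping_eqI)
    (auto simp: lookup_sum lookup_single when_def in_keys_iff)

lemma mpoly_eval_mult: "mpoly_eval x (P * Q) = mpoly_eval x P * mpoly_eval x Q"
proof -
  let ?s = Poly_Mapping.single and ?l = Poly_Mapping.lookup and ?k = Poly_Mapping.keys
  have "P * Q = (\<Sum>m\<in>?k P. ?s m (?l P m)) * (\<Sum>m\<in>?k Q. ?s m (?l Q m))"
    using poly_mapping_eq_sum_single[of P] poly_mapping_eq_sum_single[of Q] by simp
  also have "mpoly_eval x \<dots> =
      (\<Sum>m\<in>?k P. mpoly_eval x (?s m (?l P m))) * (\<Sum>m\<in>?k Q. mpoly_eval x (?s m (?l Q m)))"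
    by (simp add: sum_product mpoly_eval_sum mult_single mpoly_eval_single lookup_add power_add
        prod.distrib of_rat_mult mult_ac)
  also have "\<dots> = mpoly_eval x P * mpoly_eval x Q"
    using poly_mapping_eq_sum_single[of P] poly_mapping_eq_sum_single[of Q]
    by (simp flip: mpoly_eval_sum)
  finally show ?thesis .
qed

interpretation mpoly_eval: comm_ring_hom "mpoly_eval x" for x :: "'n::finite \<Rightarrow> complex"
proof
  show "mpoly_eval x 1 = 1"
    using mpoly_eval_single[of x 0 1] by simp
qed (simp_all add: mpoly_eval_0 mpoly_eval_add mpoly_eval_mult)

interpretation map_mpoly_eval: map_poly_comm_ring_hom "mpoly_eval x" for x :: "'n::finite \<Rightarrow> complex" ..

interpretation zpoly_eval: comm_ring_hom "zpoly_eval x v" for x :: "'n::finite \<Rightarrow> complex" and v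
  by unfold_locales (simp_all add: zpoly_eval_def hom_distribs)

lemma zpoly_eval_pCons: "zpoly_eval x v (pCons c p) = mpoly_eval x c + v * zpoly_eval x v p"
  by (simp add: zpoly_eval_def hom_distribs)

text \<open>The first number is the value of \<open>z\<close>, the second that of \<open>t\<close>:
  later a value of the whole expression and one of its right operand or radicand.\<close>

definition tpoly_eval :: "('n::finite \<Rightarrow> complex) \<Rightarrow> complex \<Rightarrow> complex \<Rightarrow> 'n mpoly poly poly \<Rightarrow> complex" where
  "tpoly_eval x v w p = poly (map_poly (zpoly_eval x v) p) w"

interpretation map_zpoly_eval: map_poly_comm_ring_hom "zpoly_eval x v" for x :: "'n::finite \<Rightarrow> complex" and v ..

interpretation tpoly_eval: comm_ring_hom "tpoly_eval x v w" for x :: "'n::finite \<Rightarrow> complex" and v w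
  by unfold_locales (simp_all add: tpoly_eval_def hom_distribs)

lemma tpoly_eval_pCons: "tpoly_eval x v w (pCons c p) = zpoly_eval x v c + w * tpoly_eval x v w p"
  by (simp add: tpoly_eval_def hom_distribs)

section \<open>Evaluation after substitution\<close>

lemma psubst_0: "psubst 0 s = 0"
  by (simp add: psubst_def)

lemma psubst_pCons: "psubst (pCons c p) s = [:[:c:]:] + s * psubst p s"
  by (cases "c = 0 \<and> p = 0") (auto simp: psubst_def map_poly_pCons)

lemma tpoly_eval_psubst: "tpoly_eval x v w (psubst p s) = zpoly_eval x (tpoly_eval x v w s) p"
  by (induction p)
    (simp_all add: psubst_0 psubst_pCons zpoly_eval_pCons tpoly_eval_pCons hom_distribs)

lemma psubst_var_t: "psubst p var_t = map_poly (\<lambda>c. [:c:]) p"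
  by (induction p) (simp_all add: psubst_0 psubst_pCons map_poly_pCons)

text \<open>Embedding coefficients as constants in \<open>z\<close> is injective. Positive degree of
  a defining polynomial thus becomes positive degree in \<open>t\<close>, which keeps the Sylvester
  matrix nonempty.\<close>

lemma degree_psubst_var_t: "degree (psubst p var_t) = degree p"
  unfolding psubst_var_t by (rule Polynomial.degree_map_poly) auto

text \<open>Each term \<open>z^i * t^(d-i)\<close> becomes \<open>u^i * w^d\<close> at
  \<open>z = u * w\<close>, \<open>t = w\<close>. No division by \<open>w\<close> occurs, so
  \<open>w = 0\<close> is covered.\<close>

lemma tpoly_eval_homogenize:
  "tpoly_eval x (u * w) w (homogenize p) = w ^ degree p * zpoly_eval x u p"
proof -
  have "zpoly_eval x u p = (\<Sum>i\<le>degree p. mpoly_eval x (coeff p i) * u ^ i)"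
    unfolding zpoly_eval_def
    by (subst poly_eq_sum_coeff[OF degree_map_poly_le]) simp
  moreover have "(u * w) ^ i * w ^ (degree p - i) = w ^ degree p * u ^ i" if "i \<le> degree p" for i
    using that by (simp add: power_mult_distrib mult_ac flip: power_add)
  ultimately show ?thesis
    by (simp add: homogenize_def tpoly_eval.hom_sum tpoly_eval.hom_mult tpoly_eval.hom_power
        tpoly_eval_pCons zpoly_eval_pCons sum_distrib_left mult_ac del: mult_pCons_left mult_pCons_right)
qed

section \<open>Lifting values to nearby points\<close>

text \<open>Coefficients are compared one variable at a time.\<close>

lemma monomials_linearly_independent:
  fixes a :: "('n \<Rightarrow> nat) \<Rightarrow> complex" and X :: "'n \<Rightarrow> complex set"
  assumes "finite A" "finite S" "inj_on (\<lambda>m. restrict m A) S" "\<And>i. infinite (X i)"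
    and "\<And>x. (\<And>i. x i \<in> X i) \<Longrightarrow> (\<Sum>m\<in>S. a m * (\<Prod>i\<in>A. x i ^ m i)) = 0"
    and "m \<in> S"
  shows "a m = 0"
  using assms
proof (induction A arbitrary: S m rule: finite_induct)
  case empty
  hence "S = {m}"
    by (auto simp: inj_on_def)
  moreover obtain x where "\<And>i. x i \<in> X i"
    using empty.prems(3) that[of "\<lambda>i. SOME t. t \<in> X i"] by (metis finite.emptyI some_in_eq)
  ultimately show ?case
    using empty.prems(4)[of x] by simp
next
  case (insert j A)
  \<comment> \<open>\<open>T\<close> collects the exponents contributing to the power
    \<open>m j\<close> of the variable \<open>j\<close>; on \<open>T\<close> restriction to
    \<open>A\<close> alone is still injective.\<close>
  define T where "T = {m' \<in> S. m' j = m j}"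
  show ?case
  proof (rule insert.IH[of T])
    show "finite T" "m \<in> T"
      using insert.prems by (auto simp: T_def)
    show "infinite (X i)" for i by fact
    show "inj_on (\<lambda>m. restrict m A) T"
    proof (rule inj_onI)
      fix m1 m2 assume *: "m1 \<in> T" "m2 \<in> T" "restrict m1 A = restrict m2 A"
      have "restrict m1 (insert j A) = restrict m2 (insert j A)"
      proof
        fix i show "restrict m1 (insert j A) i = restrict m2 (insert j A) i"
          using fun_cong[OF *(3), of i] *(1,2) by (auto simp: T_def restrict_def split: if_splits)
      qed
      thus "m1 = m2"
        using inj_onD[OF insert.prems(2)] *(1,2) unfolding T_def by blast
    qed
    fix x assume x: "\<And>i. x i \<in> X i"
    \<comment> \<open>\<open>q\<close> is the sum as a polynomial in the coordinate
      \<open>j\<close>, the others being fixed; infinitely many roots force its coefficient at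
      \<open>m j\<close> to vanish.\<close>
    define q where "q = (\<Sum>m\<in>S. monom (a m * (\<Prod>i\<in>A. x i ^ m i)) (m j))"
    have "poly q t = 0" if t: "t \<in> X j" for t
    proof -
      have "(\<Prod>i\<in>A. (x(j := t)) i ^ m i) = (\<Prod>i\<in>A. x i ^ m i)" for m :: "'n \<Rightarrow> nat"
        using insert.hyps by (intro prod.cong) auto
      moreover have "(\<Sum>m\<in>S. a m * (\<Prod>i\<in>insert j A. (x(j := t)) i ^ m i)) = 0"
        using x t by (intro insert.prems(4)) auto
      ultimately show ?thesis
        using insert.hyps by (simp add: q_def poly_sum poly_monom mult_ac)
    qed
    hence "X j \<subseteq> {t. poly q t = 0}" by auto
    hence "q = 0"
      using insert.prems(3)[of j] poly_roots_finite finite_subset by blast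
    hence "0 = coeff q (m j)" by simp
    also have "\<dots> = (\<Sum>m'\<in>S. if m' j = m j then a m' * (\<Prod>i\<in>A. x i ^ m' i) else 0)"
      by (auto simp: q_def coeff_sum intro!: sum.cong)
    also have "\<dots> = (\<Sum>m\<in>T. a m * (\<Prod>i\<in>A. x i ^ m i))"
      using insert.prems(1) unfolding T_def by (subst sum.inter_filter) auto
    finally show "(\<Sum>m\<in>T. a m * (\<Prod>i\<in>A. x i ^ m i)) = 0" ..
  qed
qed

section \<open>Points near \<open>x\<close> where a nonzero polynomial does not vanish\<close>

lemma mpoly_eval_nonzero_in_box:
  fixes X :: "'n::finite \<Rightarrow> complex set"
  assumes "P \<noteq> 0" "\<And>i. infinite (X i)"
  obtains x where "\<And>i. x i \<in> X i" "mpoly_eval x P \<noteq> 0"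
proof (rule ccontr)
  assume *: "\<not> thesis"
  obtain k where k: "k \<in> Poly_Mapping.keys P"
    using assms(1) by (metis ex_in_conv keys_eq_empty)
  define S where "S = Poly_Mapping.lookup ` Poly_Mapping.keys P"
  \<comment> \<open>Linear independence is stated for exponents that are plain functions, hence the
    detour through \<open>Abs_poly_mapping\<close>.\<close>
  define a :: "('n \<Rightarrow> nat) \<Rightarrow> complex" where
    "a m = of_rat (Poly_Mapping.lookup P (Poly_Mapping.Abs_poly_mapping m))" for m
  have "a (Poly_Mapping.lookup k) = 0"
  proof (rule monomials_linearly_independent[of UNIV S X])
    show "infinite (X i)" for i by fact
    show "inj_on (\<lambda>m. restrict m UNIV) S" by (simp add: inj_on_def restrict_def)
    fix x assume "\<And>i. x i \<in> X i"
    with * that have "mpoly_eval x P = 0" by blast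
    thus "(\<Sum>m\<in>S. a m * (\<Prod>i\<in>UNIV. x i ^ m i)) = 0"
      unfolding S_def
      by (subst sum.reindex)
        (auto simp: a_def lookup_inverse mpoly_eval_def inj_on_def intro: poly_mapping_eqI)
  qed (use k in \<open>auto simp: S_def\<close>)
  thus False
    using k by (simp add: a_def lookup_inverse in_keys_iff)
qed

text \<open>Complex balls are infinite, so a point where \<open>P\<close> is nonzero can be picked
  from each box of radius \<open>1/(k+1)\<close> around \<open>x\<close>.\<close>

lemma mpoly_eval_nonzero_near:
  fixes x :: "'n::finite \<Rightarrow> complex"
  assumes "P \<noteq> 0"
  obtains X where "\<And>i. (\<lambda>k::nat. X k i) \<longlonglongrightarrow> x i" "\<And>k. mpoly_eval (X k) P \<noteq> 0"
proof -
  have "\<exists>y. (\<forall>i. y i \<in> ball (x i) (inverse (real (Suc k)))) \<and> mpoly_eval y P \<noteq> 0" for k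
  proof -
    have "infinite (ball (x i) (inverse (real (Suc k))))" for i
      using uncountable_ball[of "inverse (real (Suc k))" "x i"] countable_finite by auto
    thus ?thesis
      using mpoly_eval_nonzero_in_box[OF assms, of "\<lambda>i. ball (x i) (inverse (real (Suc k)))"]
      by metis
  qed
  then obtain X where X: "\<And>k i. X k i \<in> ball (x i) (inverse (real (Suc k)))"
      "\<And>k. mpoly_eval (X k) P \<noteq> 0"
    by metis
  have "(\<lambda>k. X k i) \<longlonglongrightarrow> x i" for i
  proof (rule metric_LIMSEQ_I)
    fix r :: real assume "r > 0"
    then obtain N where N: "inverse (real (Suc N)) < r"
      using reals_Archimedean by blast
    have "dist (X k i) (x i) < r" if "k \<ge> N" for k
    proof -
      have "dist (X k i) (x i) < inverse (real (Suc k))"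
        using X(1)[of k i] by (simp add: dist_commute)
      also have "\<dots> \<le> inverse (real (Suc N))"
        using that by (intro le_imp_inverse_le) auto
      finally show ?thesis using N by simp
    qed
    thus "\<exists>N. \<forall>k\<ge>N. dist (X k i) (x i) < r" by blast
  qed
  with X(2) show ?thesis using that by blast
qed

section \<open>Continuity of roots and of values\<close>

lemma exp_Ln_divide_power:
  assumes "z \<noteq> 0" "r > 0"
  shows "exp (Ln z / of_nat r) ^ r = z"
  using assms by (simp flip: exp_of_nat_mult)

text \<open>If \<open>v\<close> is nonzero, \<open>U / v ^ r\<close> tends to \<open>1\<close>,
  where the principal logarithm is continuous, and the factor \<open>v\<close> selects the branch
  through \<open>v\<close>. If \<open>v = 0\<close>, any choice of roots works, since its modulus is
  the real root of the modulus of \<open>U\<close>.\<close>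

lemma tendsto_complex_root:
  fixes U :: "'a \<Rightarrow> complex"
  assumes U: "(U \<longlongrightarrow> v ^ r) F" and r: "r > 0"
  obtains V where "(V \<longlongrightarrow> v) F" "eventually (\<lambda>s. V s ^ r = U s) F"
proof (cases "v = 0")
  case True
  define V where "V s = (if U s = 0 then 0 else exp (Ln (U s) / of_nat r))" for s
  have V: "V s ^ r = U s" for s
    using exp_Ln_divide_power r by (auto simp: V_def)
  have "norm (V s) = root r (norm (U s))" for s
    using r by (simp flip: V add: norm_power real_root_power_cancel)
  moreover have "((\<lambda>s. root r (norm (U s))) \<longlongrightarrow> root r (norm (v ^ r))) F"
    by (intro tendsto_intros U)
  ultimately have "(V \<longlongrightarrow> v) F"
    using True r by (simp add: power_0_left tendsto_norm_zero_cancel)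
  with V show ?thesis using that by auto
next
  case False
  define V where "V s = v * exp (Ln (U s / v ^ r) / of_nat r)" for s
  have "((\<lambda>s. v * exp (Ln (U s / v ^ r) / of_nat r)) \<longlongrightarrow>
      v * exp (Ln (v ^ r / v ^ r) / of_nat r)) F"
    using False r by (intro tendsto_intros U) auto
  hence "(V \<longlongrightarrow> v) F"
    using False by (simp add: V_def [abs_def])
  \<comment> \<open>\<open>V s\<close> is never \<open>0\<close> here, so
    \<open>V s ^ r = U s\<close> can hold only where \<open>U s\<close> is nonzero, which is so
    eventually.\<close>
  moreover have "eventually (\<lambda>s. U s \<noteq> 0) F"
    using tendsto_imp_eventually_ne[OF U, of 0] False by simp
  hence "eventually (\<lambda>s. V s ^ r = U s) F"
    by eventually_elim
      (use False r in \<open>simp add: V_def power_mult_distrib exp_Ln_divide_power\<close>)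
  ultimately show ?thesis using that by blast
qed

text \<open>Induction on the derivation of the value: each radical takes the branch continuing the
  given value, and a denominator with nonzero limit is eventually nonzero. Positivity of the index
  matters at radicals: for index \<open>0\<close> the radicand would have to stay equal to
  \<open>1\<close>.\<close>

lemma has_value_lift:
  fixes x :: "'n::finite \<Rightarrow> complex"
  assumes "has_value x f v" "radical_expression f" and X: "\<And>i. ((\<lambda>s. X s i) \<longlongrightarrow> x i) F"
  shows "\<exists>V. (V \<longlongrightarrow> v) F \<and> eventually (\<lambda>s. has_value (X s) f (V s)) F"
  using assms(1,2)
proof induction
  case (1 P)
  have "((\<lambda>s. mpoly_eval (X s) P) \<longlongrightarrow> mpoly_eval x P) F"
    unfolding mpoly_eval_def by (intro tendsto_intros X)
  thus ?case
    by (intro exI[of _ "\<lambda>s. mpoly_eval (X s) P"]) (simp add: has_value.intros(1))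
next
  case (2 g u h w)
  then obtain U W where *: "(U \<longlongrightarrow> u) F" "(W \<longlongrightarrow> w) F"
    "eventually (\<lambda>s. has_value (X s) g (U s)) F" "eventually (\<lambda>s. has_value (X s) h (W s)) F"
    by auto
  have "eventually (\<lambda>s. has_value (X s) (RAdd g h) (U s + W s)) F"
    using *(3,4) by eventually_elim (rule has_value.intros)
  with tendsto_add[OF *(1,2)] show ?case by blast
next
  case (3 g u h w)
  then obtain U W where *: "(U \<longlongrightarrow> u) F" "(W \<longlongrightarrow> w) F"
    "eventually (\<lambda>s. has_value (X s) g (U s)) F" "eventually (\<lambda>s. has_value (X s) h (W s)) F"
    by auto
  have "eventually (\<lambda>s. has_value (X s) (RSub g h) (U s - W s)) F"
    using *(3,4) by eventually_elim (rule has_value.intros)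
  with tendsto_diff[OF *(1,2)] show ?case by blast
next
  case (4 g u h w)
  then obtain U W where *: "(U \<longlongrightarrow> u) F" "(W \<longlongrightarrow> w) F"
    "eventually (\<lambda>s. has_value (X s) g (U s)) F" "eventually (\<lambda>s. has_value (X s) h (W s)) F"
    by auto
  have "eventually (\<lambda>s. has_value (X s) (RMul g h) (U s * W s)) F"
    using *(3,4) by eventually_elim (rule has_value.intros)
  with tendsto_mult[OF *(1,2)] show ?case by blast
next
  case (5 g u h w)
  then obtain U W where *: "(U \<longlongrightarrow> u) F" "(W \<longlongrightarrow> w) F"
    "eventually (\<lambda>s. has_value (X s) g (U s)) F" "eventually (\<lambda>s. has_value (X s) h (W s)) F"
    by auto
  have "eventually (\<lambda>s. W s \<noteq> 0) F"
    using tendsto_imp_eventually_ne[OF *(2) \<open>w \<noteq> 0\<close>] .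
  with *(3,4) have "eventually (\<lambda>s. has_value (X s) (RDiv g h) (U s / W s)) F"
    by eventually_elim (rule has_value.intros)
  with tendsto_divide[OF *(1,2) \<open>w \<noteq> 0\<close>] show ?case by blast
next
  case (6 g u v r)
  then obtain U where U: "(U \<longlongrightarrow> v ^ r) F" "eventually (\<lambda>s. has_value (X s) g (U s)) F"
    by auto
  obtain V where V: "(V \<longlongrightarrow> v) F" "eventually (\<lambda>s. V s ^ r = U s) F"
    using tendsto_complex_root[OF U(1)] 6 by auto
  from U(2) V(2) have "eventually (\<lambda>s. has_value (X s) (RRoot r g) (V s)) F"
    by eventually_elim (rule has_value.intros)
  with V(1) show ?case by blast
qed

lemma constant_defining_polynomial_imp_no_value:
  assumes "defining_polynomial p f" "radical_expression f" "degree p = 0" "p \<noteq> 0"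
  shows "\<not> has_value x f v"
proof
  assume "has_value x f v"
  obtain c where p: "p = [:c:]" and c: "c \<noteq> 0"
    using assms(3,4) by (metis degree_eq_zeroE pCons_0_0)
  obtain X where X: "\<And>i. (\<lambda>k::nat. X k i) \<longlonglongrightarrow> x i" "\<And>k. mpoly_eval (X k) c \<noteq> 0"
    using mpoly_eval_nonzero_near[OF c] by metis
  obtain V where "eventually (\<lambda>k. has_value (X k) f (V k)) sequentially"
    using has_value_lift[OF \<open>has_value x f v\<close> assms(2) X(1)] by blast
  then obtain k where "has_value (X k) f (V k)"
    by (auto simp: eventually_sequentially)
  with assms(1) have "mpoly_eval (X k) c = 0"
    by (auto simp: defining_polynomial_def p zpoly_eval_pCons)
  with X(2) show False by blast
qed

section \<open>Correctness of the procedure\<close>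

lemma has_value_as_poly:
  assumes "has_value x f v" "as_poly f = Some P"
  shows "v = mpoly_eval x P"
  using assms
proof (induction arbitrary: P)
  case (5 g u h w)
  then obtain A B where *: "as_poly g = Some A" "as_poly h = Some B" "Poly_Mapping.keys B = {0}"
    and P: "P = A * Poly_Mapping.single 0 (inverse (Poly_Mapping.lookup B 0))"
    by (auto split: option.splits if_splits)
  have "w = of_rat (Poly_Mapping.lookup B 0)"
    using 5 * by (simp add: mpoly_eval_def)
  thus ?case
    using 5 * by (simp add: P mpoly_eval_mult mpoly_eval_single of_rat_inverse divide_inverse)
qed (auto split: option.splits simp: hom_distribs)

lemma zpoly_eval_Res_eq_0:
  assumes "degree p + degree q > 0" "tpoly_eval x v w p = 0" "tpoly_eval x v w q = 0"
  shows "zpoly_eval x v (Res p q) = 0"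
  using assms unfolding tpoly_eval_def
  by (intro hom_Res_eq_0[of "zpoly_eval x v" p q w]) (simp_all add: zpoly_eval.comm_ring_hom_axioms)

text \<open>Shared by all operations: the value \<open>w\<close> is a root of the second argument
  because \<open>q\<close> is a defining polynomial, leaving one vanishing condition per operation.
  If \<open>q = 0\<close> the convention in \<open>Res\<close> applies; otherwise \<open>q\<close>
  has positive degree because \<open>h\<close> has a value.\<close>

lemma zpoly_eval_Res_psubst_eq_0:
  assumes "defining_polynomial q h" "radical_expression h" "has_value x h w"
    and "tpoly_eval x v w p = 0"
  shows "zpoly_eval x v (Res p (psubst q var_t)) = 0"
proof (cases "q = 0")
  case False
  hence "degree q > 0"
    using constant_defining_polynomial_imp_no_value assms(1-3) by blast
  thus ?thesis
    using assms
    by (intro zpoly_eval_Res_eq_0[where w = w])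
      (simp_all add: degree_psubst_var_t tpoly_eval_psubst tpoly_eval_pCons zpoly_eval_pCons
        defining_polynomial_def)
qed (simp add: Res_def psubst_0)

lemma RecursiveDefPoly_as_poly:
  assumes "as_poly f = Some P"
  shows "RecursiveDefPoly_dom f \<and> defining_polynomial (RecursiveDefPoly f) f"
proof
  show dom: "RecursiveDefPoly_dom f"
    \<comment> \<open>The polynomial test succeeds, so no recursive call is made.\<close>
    using assms by - (rule RecursiveDefPoly.domintros; auto)
  show "defining_polynomial (RecursiveDefPoly f) f"
    using has_value_as_poly[OF _ assms] dom assms
    by (auto simp: defining_polynomial_def RecursiveDefPoly.psimps zpoly_eval_pCons hom_distribs)
qed

theorem theorem1:
  fixes f :: "'n::finite rexp"
  assumes "radical_expression f"
  shows "RecursiveDefPoly_dom f \<and> defining_polynomial (RecursiveDefPoly f) f"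
  using assms
proof (induction f)
  case (RPoly P)
  show ?case by (rule RecursiveDefPoly_as_poly) simp
next
  case (RAdd g h)
  let ?p = RecursiveDefPoly
  show ?case
  proof (cases "as_poly (RAdd g h)")
    case None
    have dom: "RecursiveDefPoly_dom (RAdd g h)"
      using RAdd by - (rule RecursiveDefPoly.domintros; auto)
    have eq: "?p (RAdd g h) = Res (psubst (?p g) (var_z - var_t)) (psubst (?p h) var_t)"
      using dom None by (simp add: RecursiveDefPoly.psimps)
    have "defining_polynomial (?p (RAdd g h)) (RAdd g h)"
      unfolding defining_polynomial_def
    proof (intro allI impI)
      fix x v assume "has_value x (RAdd g h) v"
      then obtain u w where uw: "has_value x g u" "has_value x h w" "v = u + w"
        by cases auto
      have "zpoly_eval x u (?p g) = 0"
        using RAdd uw(1) by (simp add: defining_polynomial_def)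
      \<comment> \<open>At \<open>z = u + w\<close>, \<open>t = w\<close> the substituted
        \<open>z - t\<close> has value \<open>u\<close>.\<close>
      thus "zpoly_eval x v (?p (RAdd g h)) = 0"
        unfolding eq using RAdd uw
        by (intro zpoly_eval_Res_psubst_eq_0[where w = w and h = h]) (simp_all add: tpoly_eval_psubst hom_distribs tpoly_eval_pCons zpoly_eval_pCons)
    qed
    with dom show ?thesis ..
  qed (rule RecursiveDefPoly_as_poly)
next
  case (RSub g h)
  let ?p = RecursiveDefPoly
  show ?case
  proof (cases "as_poly (RSub g h)")
    case None
    have dom: "RecursiveDefPoly_dom (RSub g h)"
      using RSub by - (rule RecursiveDefPoly.domintros; auto)
    have eq: "?p (RSub g h) = Res (psubst (?p g) (var_z + var_t)) (psubst (?p h) var_t)"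
      using dom None by (simp add: RecursiveDefPoly.psimps)
    have "defining_polynomial (?p (RSub g h)) (RSub g h)"
      unfolding defining_polynomial_def
    proof (intro allI impI)
      fix x v assume "has_value x (RSub g h) v"
      then obtain u w where uw: "has_value x g u" "has_value x h w" "v = u - w"
        by cases auto
      have "zpoly_eval x u (?p g) = 0"
        using RSub uw(1) by (simp add: defining_polynomial_def)
      thus "zpoly_eval x v (?p (RSub g h)) = 0"
        unfolding eq using RSub uw
        by (intro zpoly_eval_Res_psubst_eq_0[where w = w and h = h]) (simp_all add: tpoly_eval_psubst hom_distribs tpoly_eval_pCons zpoly_eval_pCons)
    qed
    with dom show ?thesis ..
  qed (rule RecursiveDefPoly_as_poly)
next
  case (RMul g h)
  let ?p = RecursiveDefPoly
  show ?case
  proof (cases "as_poly (RMul g h)")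
    case None
    have dom: "RecursiveDefPoly_dom (RMul g h)"
      using RMul by - (rule RecursiveDefPoly.domintros; auto)
    have eq: "?p (RMul g h) = Res (homogenize (?p g)) (psubst (?p h) var_t)"
      using dom None by (simp add: RecursiveDefPoly.psimps)
    have "defining_polynomial (?p (RMul g h)) (RMul g h)"
      unfolding defining_polynomial_def
    proof (intro allI impI)
      fix x v assume "has_value x (RMul g h) v"
      then obtain u w where uw: "has_value x g u" "has_value x h w" "v = u * w"
        by cases auto
      have "zpoly_eval x u (?p g) = 0"
        using RMul uw(1) by (simp add: defining_polynomial_def)
      \<comment> \<open>At \<open>z = u * w\<close>, \<open>t = w\<close> the homogenised polynomial
        is a power of \<open>w\<close> times the value of \<open>?p g\<close> at \<open>u\<close>,
        hence zero.\<close>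
      thus "zpoly_eval x v (?p (RMul g h)) = 0"
        unfolding eq using RMul uw
        by (intro zpoly_eval_Res_psubst_eq_0[where w = w and h = h]) (simp_all add: tpoly_eval_homogenize)
    qed
    with dom show ?thesis ..
  qed (rule RecursiveDefPoly_as_poly)
next
  case (RDiv g h)
  let ?p = RecursiveDefPoly
  show ?case
  proof (cases "as_poly (RDiv g h)")
    case None
    have dom: "RecursiveDefPoly_dom (RDiv g h)"
      using RDiv by - (rule RecursiveDefPoly.domintros; auto)
    have eq: "?p (RDiv g h) = Res (psubst (?p g) (var_t * var_z)) (psubst (?p h) var_t)"
      using dom None by (simp add: RecursiveDefPoly.psimps)
    have "defining_polynomial (?p (RDiv g h)) (RDiv g h)"
      unfolding defining_polynomial_def
    proof (intro allI impI)
      fix x v assume "has_value x (RDiv g h) v"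
      then obtain u w where uw: "has_value x g u" "has_value x h w" "v = u / w" "w \<noteq> 0"
        by cases auto
      have "zpoly_eval x u (?p g) = 0"
        using RDiv uw(1) by (simp add: defining_polynomial_def)
      \<comment> \<open>At \<open>z = u / w\<close>, \<open>t = w\<close> the product
        \<open>t * z\<close> is \<open>u\<close>, as \<open>w\<close> is nonzero.\<close>
      thus "zpoly_eval x v (?p (RDiv g h)) = 0"
        unfolding eq using RDiv uw
        by (intro zpoly_eval_Res_psubst_eq_0[where w = w and h = h]) (simp_all add: tpoly_eval_psubst hom_distribs tpoly_eval_pCons zpoly_eval_pCons)
    qed
    with dom show ?thesis ..
  qed (rule RecursiveDefPoly_as_poly)
next
  case (RRoot r g)
  let ?p = RecursiveDefPoly
  have dom: "RecursiveDefPoly_dom (RRoot r g)"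
    using RRoot by - (rule RecursiveDefPoly.domintros; auto)
  have eq: "?p (RRoot r g) = Res (var_z ^ r - var_t) (psubst (?p g) var_t)"
    using dom by (simp add: RecursiveDefPoly.psimps)
  have "defining_polynomial (?p (RRoot r g)) (RRoot r g)"
    unfolding defining_polynomial_def
  proof (intro allI impI)
    fix x v assume "has_value x (RRoot r g) v"
    then have "has_value x g (v ^ r)"
      by cases auto
    \<comment> \<open>The common root is \<open>t = v ^ r\<close>: it annihilates
      \<open>z ^ r - t\<close> at \<open>z = v\<close> and is a value of \<open>g\<close>.\<close>
    thus "zpoly_eval x v (?p (RRoot r g)) = 0"
      unfolding eq using RRoot
      by (intro zpoly_eval_Res_psubst_eq_0[where w = "v ^ r" and h = g])
        (simp_all add: hom_distribs tpoly_eval_pCons zpoly_eval_pCons)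
  qed
  with dom show ?case ..
qed

end
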